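(* Let $p$ be an odd prime and let $c,d$ be integers. For integers $a,b$ let $D_p(a,b)=\left[(i^2+aij+bj^2)^{p-2}\right]_{1\le i,j\le p-1}$ and $D_p(a)=D_p(a,1)$. Suppose $p\nmid\det D_p(c)$. Then the following results hold. (1) If $\left(\frac{c^2-4}{p}\right)=1$, then $$\left(\frac{\det D_p(c)}{p}\right)=\left(\frac{-c-2}{p}\right)^{(p-1)/2}.$$ (2) If $\left(\frac{c^2-4}{p}\right)=-1$, then $$\left(\frac{\det D_p(c)}{p}\right)=\left(\frac{-c-2}{p}\right)^{(p-1)/2}\left(\frac{2c}{p}\right).$$ (3) When $p\nmid d$, we have $$\left(\frac{\det D_p(c,d^2)}{p}\right)=\left(\frac{d}{p}\right)^{(p-1)/2}\left(\frac{\det D_p(cd^{-1})}{p}\right),$$ where $d^{-1}$ denotes an integer that is an inverse of $d$ modulo $p$.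
   Context: $\left(\frac{\cdot}{p}\right)$ denotes the Legendre symbol modulo $p$ (with value $0$ on multiples of $p$). For integers $a,b$, $D_p(a,b)$ is the $(p-1)\times(p-1)$ integer matrix whose $(i,j)$ entry is $(i^2+aij+bj^2)^{p-2}$, $1\le i,j\le p-1$. The residue of $\det D_p(a,b)$ modulo $p$ depends only on $a,b$ modulo $p$, so the choice of inverse $d^{-1}$ does not matter. *)

theory Defs
  imports "Jordan_Normal_Form.Determinant" "HOL-Number_Theory.Number_Theory"
begin

text \<open>
  Matrix indices of type \<open>mat\<close> start at 0, so position \<open>(i, j)\<close> holds the entry belonging to
  the pair \<open>(i + 1, j + 1)\<close>.
\<close>

definition D_mat :: "nat \<Rightarrow> int \<Rightarrow> int \<Rightarrow> int mat" where
  "D_mat p a b = mat (p - 1) (p - 1)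
     (\<lambda>(i, j). (int (i + 1) ^ 2 + a * int (i + 1) * int (j + 1) + b * int (j + 1) ^ 2) ^ (p - 2))"

end

theory Submission
  imports Defs
begin

text \<open>
  Modulo \<open>p\<close> every nonzero \<open>j\<close> satisfies \<open>j\<^sup>2 (i\<^sup>2 + c i j + j\<^sup>2)\<^sup>p\<^sup>-\<^sup>2 = f (i / j)\<close> with
  \<open>f x = (x\<^sup>2 + c x + 1)\<^sup>p\<^sup>-\<^sup>2\<close>, so up to the scaling of the columns by squares the matrix is a group
  matrix of the cyclic group of units, and the matrix of powers \<open>j\<^sup>l\<close> diagonalises it over the prime
  field. The eigenvalues are the negatives of \<open>S n = (\<Sum>x. x\<^sup>n f x)\<close>, and \<open>x \<mapsto> 1 / x\<close> gives
  \<open>S n = S (2 - n)\<close>. Hence the determinant is \<open>S 1 * S (h + 1)\<close> times a square, where \<open>h = (p - 1) / 2\<close>.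

  Both remaining sums become sums over \<open>u = x + 1 / x\<close>, a value taken by \<open>1 + (u\<^sup>2 - 4)\<^sup>h\<close> units \<open>x\<close>,
  with \<open>x\<^sup>h = (u + 2)\<^sup>h\<close> unless \<open>x = -1\<close>. After the shift \<open>v = u + c\<close> they have the form
  \<open>\<Sum>v. P v * v\<^sup>p\<^sup>-\<^sup>2\<close> with \<open>P\<close> of degree at most \<open>p - 1\<close>, which is \<open>- P' 0\<close>. For the third claim,
  replacing \<open>j\<close> by \<open>d j\<close> permutes the columns, and multiplies the matrix of powers by the diagonal
  matrix of the \<open>d\<^sup>l\<close>.
\<close>

section \<open>Matrix products and determinants\<close>

lemma mult_mat_mat:
  "mat n n f * mat n n g = mat n n (\<lambda>(i, j). \<Sum>k = 0..<n. f (i, k) * g (k, j))"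
  by (rule eq_matI) (auto simp: scalar_prod_def intro!: sum.cong)

lemma det_diag: "det (mat n n (\<lambda>(i, j). if i = j then f i else 0)) = (\<Prod>i = 0..<n. f i)"
  (is "det ?A = _")
proof -
  have "det ?A = prod_list (diag_mat ?A)"
    by (rule det_upper_triangular[of _ n]) auto
  also have "\<dots> = (\<Prod>i = 0..<n. f i)"
    by (simp add: diag_mat_def prod.distinct_set_conv_list[symmetric] cong: map_cong)
  finally show ?thesis .
qed

text \<open>The Leibniz formula makes the determinant a polynomial with integer coefficients in the
  entries, so it respects congruences.\<close>

lemma det_cong:
  fixes A B :: "int mat"
  assumes AB: "A \<in> carrier_mat n n" "B \<in> carrier_mat n n"
    and eq: "\<And>i j. i < n \<Longrightarrow> j < n \<Longrightarrow> [A $$ (i, j) = B $$ (i, j)] (mod m)"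
  shows "[det A = det B] (mod m)"
  unfolding det_def'[OF AB(1)] det_def'[OF AB(2)]
  by (intro cong_sum cong_mult cong_prod eq cong_refl) (auto simp: permutes_in_image)

section \<open>Arithmetic modulo an odd prime\<close>

locale odd_prime =
  fixes p :: nat
  assumes prime: "prime p" and odd: "odd p"
begin

abbreviation eqp :: "int \<Rightarrow> int \<Rightarrow> bool"  (infix \<open>\<equiv>\<^sub>p\<close> 50)
  where "a \<equiv>\<^sub>p b \<equiv> [a = b] (mod int p)"

abbreviation res :: "int set" where "res \<equiv> {0..<int p}"
abbreviation units :: "int set" where "units \<equiv> {1..<int p}"
abbreviation h :: nat where "h \<equiv> (p - 1) div 2"
abbreviation L :: "int \<Rightarrow> int" where "L a \<equiv> Legendre a (int p)"

lemma p_gt_2: "p > 2"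
  using prime odd prime_ge_2_nat[of p] by (cases "p = 2") auto

lemma p_minus_1: "p - 1 = Suc (p - 2)"
  using p_gt_2 by linarith

lemma two_h: "2 * h = p - 1"
  using odd by simp

lemma two_int_h: "2 * int h = int p - 1"
  using two_h p_gt_2 by linarith

lemma h_pos: "h > 0"
  using p_gt_2 by simp

lemma prime_int: "prime (int p)"
  using prime by simp

lemma not_dvd_mult: "\<not> int p dvd a \<Longrightarrow> \<not> int p dvd b \<Longrightarrow> \<not> int p dvd a * b"
  using prime_dvd_mult_iff[OF prime_int] by blast

lemma not_dvd_power: "\<not> int p dvd a \<Longrightarrow> \<not> int p dvd a ^ n"
  using prime_dvd_power[OF prime_int] by blast

lemma not_dvd_unit: "x \<in> units \<Longrightarrow> \<not> int p dvd x"
  by (auto dest: zdvd_imp_le)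

lemma not_dvd_2: "\<not> int p dvd 2"
  using p_gt_2 by (auto dest: zdvd_imp_le)

lemma not_dvd_4: "\<not> int p dvd 4"
  using not_dvd_mult[OF not_dvd_2 not_dvd_2] by simp

lemma cong_dvd_iff: "a \<equiv>\<^sub>p b \<Longrightarrow> int p dvd a \<longleftrightarrow> int p dvd b"
  using cong_dvd_iff by blast

lemma cong_cancel: "c * a \<equiv>\<^sub>p c * b \<Longrightarrow> \<not> int p dvd c \<Longrightarrow> a \<equiv>\<^sub>p b"
  using cong_mult_lcancel[of c "int p" a b] prime_imp_coprime[OF prime_int, of c]
  by (simp add: coprime_commute)

lemma cong_cancel_iff: "\<not> int p dvd c \<Longrightarrow> c * a \<equiv>\<^sub>p c * b \<longleftrightarrow> a \<equiv>\<^sub>p b"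
  by (meson cong_cancel cong_mult cong_refl)

lemma fermat: "\<not> int p dvd a \<Longrightarrow> a ^ (p - 1) \<equiv>\<^sub>p 1"
proof -
  assume a: "\<not> int p dvd a"
  \<comment> \<open>The least nonnegative residue carries the claim over to natural numbers.\<close>
  define b where "b = nat (a mod int p)"
  have b: "int b = a mod int p"
    using p_gt_2 by (simp add: b_def)
  have ab: "int b \<equiv>\<^sub>p a" by (simp add: b cong_def)
  have "\<not> p dvd b"
    using cong_dvd_iff[OF ab] a by simp
  from fermat_theorem[OF prime this] have "[b ^ (p - 1) = 1] (mod p)" .
  hence "int b ^ (p - 1) \<equiv>\<^sub>p 1"
    using cong_int_iff[of "b ^ (p - 1)" 1 p] by simp
  thus ?thesis
    using cong_pow[OF ab, of "p - 1"] by (meson cong_sym cong_trans)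
qed

lemma power_2h: "\<not> int p dvd a \<Longrightarrow> a ^ (2 * h) \<equiv>\<^sub>p 1"
  unfolding two_h by (rule fermat)

lemma fermat_power:
  assumes "\<not> int p dvd a" "[m = n] (mod (p - 1))"
  shows "a ^ m \<equiv>\<^sub>p a ^ n"
proof -
  have *: "a ^ k \<equiv>\<^sub>p a ^ (k mod (p - 1))" for k
  proof -
    have "a ^ k = (a ^ (p - 1)) ^ (k div (p - 1)) * a ^ (k mod (p - 1))"
      by (metis mult_div_mod_eq power_add power_mult)
    also have "\<dots> \<equiv>\<^sub>p 1 ^ (k div (p - 1)) * a ^ (k mod (p - 1))"
      by (intro cong_mult cong_pow fermat assms cong_refl)
    finally show ?thesis by simp
  qed
  from *[of m] *[of n] assms(2) show ?thesis
    unfolding cong_def by simp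
qed

text \<open>From here on \<open>x ^ (p - 2)\<close> serves as \<open>1 / x\<close>, which keeps all
  expressions integral.\<close>

lemma unit_inverse: "\<not> int p dvd x \<Longrightarrow> x * x ^ (p - 2) \<equiv>\<^sub>p 1"
proof -
  have "x * x ^ (p - 2) = x ^ (p - 1)"
    by (simp only: p_minus_1 power_Suc)
  thus "\<not> int p dvd x \<Longrightarrow> x * x ^ (p - 2) \<equiv>\<^sub>p 1"
    using fermat by simp
qed

section \<open>Legendre symbols\<close>

lemma euler: "L a \<equiv>\<^sub>p a ^ h"
  using euler_criterion[OF prime p_gt_2] .

lemma L_values: "L a = 0 \<or> L a = 1 \<or> L a = -1"
  by (simp add: Legendre_def)

lemma L_0_iff: "L a = 0 \<longleftrightarrow> int p dvd a"
  by (simp add: Legendre_def cong_0_iff)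

text \<open>Two such values differ by at most 2, which is less than \<open>p\<close>. This turns the
  congruences from Euler's criterion into equalities of signs.\<close>

lemma sign_eqI:
  assumes "a \<equiv>\<^sub>p b" "a \<in> {0, 1, -1}" "b \<in> {0, 1, -1}"
  shows "a = b"
proof -
  have "int p dvd a - b" using assms(1) by (simp add: cong_iff_dvd_diff)
  moreover have "\<bar>a - b\<bar> < int p" using assms(2,3) p_gt_2 by auto
  ultimately show ?thesis
    using dvd_imp_le_int[of "a - b" "int p"] by auto
qed

lemma L_cong: "a \<equiv>\<^sub>p b \<Longrightarrow> L a = L b"
proof (rule sign_eqI)
  assume "a \<equiv>\<^sub>p b"
  thus "L a \<equiv>\<^sub>p L b"
    using euler[of a] euler[of b] cong_pow by (meson cong_sym cong_trans)
qed (use L_values in auto)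

lemma L_mult: "L (a * b) = L a * L b"
proof (rule sign_eqI)
  have "L (a * b) \<equiv>\<^sub>p a ^ h * b ^ h"
    using euler[of "a * b"] by (simp add: power_mult_distrib)
  also have "a ^ h * b ^ h \<equiv>\<^sub>p L a * L b"
    by (intro cong_mult cong_sym[OF euler])
  finally show "L (a * b) \<equiv>\<^sub>p L a * L b" .
qed (use L_values[of a] L_values[of b] L_values[of "a * b"] in auto)

lemma L_1: "L 1 = 1"
  using euler[of 1] by (intro sign_eqI) (use L_values[of 1] in auto)

lemma L_power: "L (a ^ n) = L a ^ n"
  by (induction n) (auto simp: L_1 L_mult)

lemma L_square: "\<not> int p dvd a \<Longrightarrow> L a * L a = 1"
  using L_values[of a] L_0_iff[of a] by auto

lemma L_sign:
  assumes "e = 1 \<or> e = -1"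
  shows "L e = e ^ h"
proof (rule sign_eqI[OF euler])
  have "even h \<or> Parity.odd h" by simp
  thus "e ^ h \<in> {0, 1, -1}" using assms by (auto simp only: power_one uminus_power_if split: if_splits)
qed (use L_values in auto)

subsection \<open>Sums over residue classes\<close>

text \<open>An injective self-map of a finite set of residues is a bijection. Scaling, inversion,
  shifts and affine substitutions in sums are all instances.\<close>

lemma sum_reindex_mod:
  assumes per: "\<And>x y. x \<equiv>\<^sub>p y \<Longrightarrow> F x \<equiv>\<^sub>p F y"
    and S: "S \<subseteq> res"
    and maps: "\<And>x. x \<in> S \<Longrightarrow> g x mod int p \<in> S"
    and inj: "\<And>x y. x \<in> S \<Longrightarrow> y \<in> S \<Longrightarrow> g x \<equiv>\<^sub>p g y \<Longrightarrow> x \<equiv>\<^sub>p y"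
  shows "(\<Sum>x\<in>S. F (g x)) \<equiv>\<^sub>p (\<Sum>x\<in>S. F x)"
proof -
  have fin: "finite S" using S finite_subset by blast
  have "inj_on (\<lambda>x. g x mod int p) S"
  proof (rule inj_onI)
    fix x y assume xy: "x \<in> S" "y \<in> S" "g x mod int p = g y mod int p"
    hence "g x \<equiv>\<^sub>p g y" by (simp add: cong_def)
    hence "x \<equiv>\<^sub>p y" by (rule inj[OF xy(1,2)])
    moreover have "x \<in> res" "y \<in> res" using xy S by auto
    ultimately show "x = y" by (auto simp: cong_def)
  qed
  moreover from this have "(\<lambda>x. g x mod int p) ` S = S"
    by (intro endo_inj_surj fin) (use maps in auto)
  ultimately have "bij_betw (\<lambda>x. g x mod int p) S S" by (simp add: bij_betw_def)
  hence "(\<Sum>x\<in>S. F (g x mod int p)) = (\<Sum>x\<in>S. F x)"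
    by (rule sum.reindex_bij_betw)
  moreover have "(\<Sum>x\<in>S. F (g x)) \<equiv>\<^sub>p (\<Sum>x\<in>S. F (g x mod int p))"
    by (intro cong_sum per) (simp add: cong_def)
  ultimately show ?thesis by simp
qed

lemma mod_in_units:
  assumes "\<not> int p dvd x"
  shows "x mod int p \<in> units"
proof -
  have "x mod int p \<noteq> 0" "x mod int p \<ge> 0" "x mod int p < int p"
    using assms p_gt_2 by (auto simp: dvd_eq_mod_eq_0)
  thus ?thesis by simp
qed

lemma sum_units_scale:
  assumes per: "\<And>x y. x \<equiv>\<^sub>p y \<Longrightarrow> F x \<equiv>\<^sub>p F y" and d: "\<not> int p dvd d"
  shows "(\<Sum>x\<in>units. F (d * x)) \<equiv>\<^sub>p (\<Sum>x\<in>units. F x)"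
proof (rule sum_reindex_mod[where F = F and g = "\<lambda>x. d * x"])
  fix x assume "x \<in> units"
  thus "d * x mod int p \<in> units"
    by (intro mod_in_units not_dvd_mult d not_dvd_unit)
next
  show "d * x \<equiv>\<^sub>p d * y \<Longrightarrow> x \<equiv>\<^sub>p y" for x y
    using d by (rule cong_cancel[rotated])
qed (use per in auto)

lemma sum_units_inverse:
  assumes per: "\<And>x y. x \<equiv>\<^sub>p y \<Longrightarrow> F x \<equiv>\<^sub>p F y"
  shows "(\<Sum>x\<in>units. F (x ^ (p - 2))) \<equiv>\<^sub>p (\<Sum>x\<in>units. F x)"
proof (rule sum_reindex_mod[where F = F and g = "\<lambda>x. x ^ (p - 2)"])
  fix x y assume xy: "x \<in> units" "y \<in> units" "x ^ (p - 2) \<equiv>\<^sub>p y ^ (p - 2)"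
  note inv = unit_inverse[OF not_dvd_unit]
  \<comment> \<open>Injectivity of inversion:
    \<open>x = x * y * (1 / y) = x * y * (1 / x) = y\<close>.\<close>
  have "x * 1 \<equiv>\<^sub>p x * (y * y ^ (p - 2))"
    by (intro cong_mult cong_sym[OF inv[OF xy(2)]] cong_refl)
  also have "x * (y * y ^ (p - 2)) \<equiv>\<^sub>p x * (y * x ^ (p - 2))"
    by (intro cong_mult cong_sym[OF xy(3)] cong_refl)
  also have "x * (y * x ^ (p - 2)) = y * (x * x ^ (p - 2))" by (simp add: mult_ac)
  also have "\<dots> \<equiv>\<^sub>p y * 1" by (intro cong_mult inv xy cong_refl)
  finally show "x \<equiv>\<^sub>p y" by simp
next
  fix x assume "x \<in> units"
  thus "x ^ (p - 2) mod int p \<in> units"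
    by (intro mod_in_units not_dvd_power not_dvd_unit)
qed (use per in auto)

lemma sum_residues_shift:
  assumes per: "\<And>x y. x \<equiv>\<^sub>p y \<Longrightarrow> F x \<equiv>\<^sub>p F y"
  shows "(\<Sum>x\<in>res. F (x + c)) \<equiv>\<^sub>p (\<Sum>x\<in>res. F x)"
proof (rule sum_reindex_mod[where F = F and g = "\<lambda>x. x + c"])
  show "x + c \<equiv>\<^sub>p y + c \<Longrightarrow> x \<equiv>\<^sub>p y" for x y
    by (simp only: cong_add_rcancel)
  show "(x + c) mod int p \<in> res" for x
    using p_gt_2 by simp
qed (use per in auto)

lemma sum_powers_dvd:
  assumes "(p - 1) dvd e"
  shows "(\<Sum>x\<in>units. x ^ e) \<equiv>\<^sub>p -1"
proof -
  have "(\<Sum>x\<in>units. x ^ e) \<equiv>\<^sub>p (\<Sum>x\<in>units. x ^ 0)"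
    by (intro cong_sum fermat_power not_dvd_unit) (use assms in \<open>auto simp: cong_0_iff\<close>)
  also have "(\<Sum>x\<in>units. x ^ 0) = int p - 1" using p_gt_2 by simp
  also have "\<dots> \<equiv>\<^sub>p -1" by (simp add: cong_iff_dvd_diff)
  finally show ?thesis .
qed

text \<open>A primitive root has order exactly \<open>p - 1\<close>, so its \<open>e\<close>-th
  power is 1 only when \<open>p - 1\<close> divides \<open>e\<close>.\<close>

lemma ex_power_ne_1:
  assumes "\<not> (p - 1) dvd e"
  obtains g where "\<not> int p dvd g" "\<not> g ^ e \<equiv>\<^sub>p 1"
proof -
  obtain g where "residue_primroot p g"
    using prime_primitive_root_exists[of p] prime p_gt_2 by auto
  hence g: "coprime p g" "ord p g = p - 1"
    using prime by (auto simp: residue_primroot_def totient_prime)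
  have "\<not> p dvd g" using g(1) prime
    by (meson coprime_absorb_left not_prime_unit)
  moreover have "\<not> [g ^ e = 1] (mod p)"
    using g assms ord_divides[of g e p] by auto
  moreover from this have "\<not> int g ^ e \<equiv>\<^sub>p 1"
    using cong_int_iff[of "g ^ e" 1 p] by simp
  ultimately show ?thesis
    by (intro that[of "int g"]) simp_all
qed

text \<open>Scaling \<open>x\<close> by \<open>g\<close> permutes the units and multiplies the sum
  by \<open>g ^ e\<close>. Since \<open>g ^ e\<close> is not 1, the sum must vanish.\<close>

lemma sum_powers_not_dvd:
  assumes "\<not> (p - 1) dvd e"
  shows "(\<Sum>x\<in>units. x ^ e) \<equiv>\<^sub>p 0"
proof -
  obtain g where g: "\<not> int p dvd g" "\<not> g ^ e \<equiv>\<^sub>p 1"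
    using ex_power_ne_1[OF assms] .
  have "(\<Sum>x\<in>units. (g * x) ^ e) \<equiv>\<^sub>p (\<Sum>x\<in>units. x ^ e)"
    by (intro sum_units_scale[where F = "\<lambda>x. x ^ e"] cong_pow g)
  hence "int p dvd (g ^ e - 1) * (\<Sum>x\<in>units. x ^ e)"
    by (simp add: cong_iff_dvd_diff power_mult_distrib left_diff_distrib flip: sum_distrib_left)
  moreover have "\<not> int p dvd g ^ e - 1" using g(2) by (simp add: cong_iff_dvd_diff)
  ultimately show ?thesis
    using prime_dvd_mult_iff[OF prime_int] by (auto simp: cong_0_iff)
qed

lemma poly_cong: "x \<equiv>\<^sub>p y \<Longrightarrow> poly P x \<equiv>\<^sub>p poly P y"
  by (induction P) (auto intro!: cong_add cong_mult)

text \<open>The monomial of degree \<open>i\<close> contributes a power sum with exponent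
  \<open>i + (p - 2)\<close>, which survives only when \<open>p - 1\<close> divides that exponent.
  For \<open>i\<close> up to \<open>p - 1\<close> this leaves \<open>i = 1\<close> alone, with power
  sum -1. The degree bound is sharp, since \<open>i = p\<close> would survive as well.\<close>

lemma sum_poly_power:
  fixes P :: "int poly"
  assumes "degree P \<le> p - 1"
  shows "(\<Sum>v\<in>res. poly P v * v ^ (p - 2)) \<equiv>\<^sub>p - poly (pderiv P) 0"
proof -
  have R: "res = insert 0 units" using p_gt_2 by auto
  have c: "(\<Sum>v\<in>units. v ^ (i + (p - 2))) \<equiv>\<^sub>p (if i = 1 then - 1 else 0)" if "i \<le> p - 1" for i
  proof (cases "i = 1")
    case True
    have e: "i + (p - 2) = p - 1" using True p_gt_2 by linarith
    show ?thesis unfolding e if_P[OF True] by (rule sum_powers_dvd) (rule dvd_refl)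
  next
    case False
    have "\<not> (p - 1) dvd i + (p - 2)"
    proof
      assume "(p - 1) dvd i + (p - 2)"
      then obtain k where k: "i + (p - 2) = (p - 1) * k" by blast
      \<comment> \<open>The exponent lies strictly between 0 and \<open>2 * (p - 1)\<close>, so the
        only possible multiple is \<open>p - 1\<close> itself, which means
        \<open>i = 1\<close>.\<close>
      have "(p - 1) * k < (p - 1) * 2" "(p - 1) * 0 < (p - 1) * k"
        using that p_gt_2 unfolding k[symmetric] by auto
      hence "k < 2" "0 < k" by (simp_all only: mult_less_cancel1)
      hence "k = 1" by simp
      thus False using k False p_gt_2 by simp
    qed
    from sum_powers_not_dvd[OF this] show ?thesis using False by simp
  qed
  have "(\<Sum>v\<in>res. poly P v * v ^ (p - 2)) = (\<Sum>v\<in>units. poly P v * v ^ (p - 2))"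
    unfolding R using p_gt_2 by simp
  also have "\<dots> = (\<Sum>v\<in>units. \<Sum>i\<le>degree P. poly.coeff P i * v ^ (i + (p - 2)))"
    by (simp only: poly_altdef sum_distrib_right power_add mult.assoc)
  also have "\<dots> = (\<Sum>i\<le>degree P. poly.coeff P i * (\<Sum>v\<in>units. v ^ (i + (p - 2))))"
    by (subst sum.swap) (simp add: sum_distrib_left)
  also have "\<dots> \<equiv>\<^sub>p (\<Sum>i\<le>degree P. poly.coeff P i * (if i = 1 then - 1 else 0))"
    by (intro cong_sum cong_mult c cong_refl) (use assms in auto)
  also have "(\<Sum>i\<le>degree P. poly.coeff P i * (if i = 1 then - 1 else 0)) = - poly.coeff P 1"
  proof -
    have "(\<Sum>i\<le>degree P. poly.coeff P i * (if i = 1 then - 1 else 0))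
        = (\<Sum>i\<le>degree P. if i = 1 then - poly.coeff P 1 else 0)"
      by (rule sum.cong) auto
    \<comment> \<open>If the index 1 exceeds the degree, the coefficient is 0 and the formula still
      holds.\<close>
    also have "\<dots> = - poly.coeff P 1"
      using coeff_eq_0[of P 1] by (subst sum.delta) auto
    finally show ?thesis .
  qed
  also have "poly.coeff P 1 = poly (pderiv P) 0"
    by (simp add: poly_0_coeff_0 coeff_pderiv)
  finally show ?thesis .
qed

lemma prod_units: "(\<Prod>i = 0..<p - 1. F (int (i + 1))) = (\<Prod>x\<in>units. F x)"
  by (rule prod.reindex_bij_witness[of _ "\<lambda>x. nat (x - 1)" "\<lambda>i. int (i + 1)"]) (use p_gt_2 in auto)

lemma sum_units: "(\<Sum>i = 0..<p - 1. F (int (i + 1))) = (\<Sum>x\<in>units. F x)"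
  by (rule sum.reindex_bij_witness[of _ "\<lambda>x. nat (x - 1)" "\<lambda>i. int (i + 1)"]) (use p_gt_2 in auto)

subsection \<open>Diagonalisation by the matrix of powers\<close>

abbreviation umat :: "(nat \<times> nat \<Rightarrow> int) \<Rightarrow> int mat" where "umat \<equiv> mat (p - 1) (p - 1)"

text \<open>A Vandermonde matrix: column \<open>l\<close> lists the values of the character
  \<open>x \<mapsto> x ^ l\<close> at the units.\<close>

definition power_mat :: "int mat" where
  "power_mat = umat (\<lambda>(j, l). int (j + 1) ^ l)"

text \<open>The inverse of \<open>power_mat\<close> modulo \<open>p\<close> up to the sign -1. The
  exponent \<open>p - 1 - k\<close> stands for \<open>- k\<close>.\<close>

definition inv_power_mat :: "int mat" where
  "inv_power_mat = umat (\<lambda>(k, i). int (i + 1) ^ (p - 1 - k))"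

text \<open>Orthogonality of the characters of the unit group. The multiple
  \<open>(p - 1) * r\<close> absorbs surplus exponents that appear when inverses are written as
  powers.\<close>

lemma sum_powers_delta:
  assumes "k < p - 1" "l < p - 1"
  shows "(\<Sum>x\<in>units. x ^ (p - 1 - k + l + (p - 1) * r)) \<equiv>\<^sub>p (if k = l then -1 else 0)"
proof (cases "k = l")
  case True
  hence "p - 1 - k + l = p - 1" using assms by linarith
  hence "(p - 1) dvd p - 1 - k + l + (p - 1) * r" by (simp only: dvd_add dvd_refl dvd_triv_left)
  from sum_powers_dvd[OF this] show ?thesis using True by simp
next
  case False
  have "\<not> (p - 1) dvd (p - 1 - k + l)"
  proof
    assume "(p - 1) dvd (p - 1 - k + l)"
    then obtain t where t: "p - 1 - k + l = (p - 1) * t" by blast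
    have "(p - 1) * 0 < (p - 1) * t" "(p - 1) * t < (p - 1) * 2"
      using assms unfolding t[symmetric] by auto
    hence "t < 2" "0 < t" by (simp_all only: mult_less_cancel1)
    hence "t = 1" by simp
    thus False using t False assms by simp
  qed
  hence "\<not> (p - 1) dvd (p - 1 - k + l + (p - 1) * r)"
    by (metis dvd_add_times_triv_right_iff mult.commute)
  from sum_powers_not_dvd[OF this] show ?thesis using False by simp
qed

lemma det_inv_power_mat: "det inv_power_mat * det power_mat \<equiv>\<^sub>p 1"
proof -
  have "det (inv_power_mat * power_mat) \<equiv>\<^sub>p det (umat (\<lambda>(k, l). if k = l then -1 else 0))"
  proof (rule det_cong)
    fix k l assume kl: "k < p - 1" "l < p - 1"
    have "(inv_power_mat * power_mat) $$ (k, l)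
        = (\<Sum>i = 0..<p - 1. int (i + 1) ^ (p - 1 - k) * int (i + 1) ^ l)"
      using kl by (simp add: inv_power_mat_def power_mat_def mult_mat_mat)
    also have "\<dots> = (\<Sum>x\<in>units. x ^ (p - 1 - k + l + (p - 1) * 0))"
      by (subst sum_units[of "\<lambda>x. x ^ (p - 1 - k) * x ^ l"]) (simp add: power_add)
    also have "\<dots> \<equiv>\<^sub>p (if k = l then -1 else 0)"
      by (rule sum_powers_delta[OF kl])
    finally show "(inv_power_mat * power_mat) $$ (k, l)
        \<equiv>\<^sub>p umat (\<lambda>(k, l). if k = l then -1 else 0) $$ (k, l)"
      using kl by simp
  qed (auto simp: inv_power_mat_def power_mat_def)
  \<comment> \<open>The size \<open>p - 1\<close> is even, so the signs cancel.\<close>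
  also have "det (umat (\<lambda>(k, l). if k = l then -1 else 0)) = 1"
    using det_diag[of "p - 1" "\<lambda>_. -1"] odd by simp
  finally show ?thesis
    by (subst (asm) det_mult[of _ "p - 1"]) (auto simp: inv_power_mat_def power_mat_def)
qed

lemma not_dvd_det_power_mat: "\<not> int p dvd det power_mat"
proof
  assume "int p dvd det power_mat"
  hence "int p dvd 1" using cong_dvd_iff[OF det_inv_power_mat] by simp
  thus False using p_gt_2 by auto
qed

section \<open>The determinant as a product of eigenvalues\<close>

definition entry :: "int \<Rightarrow> int \<Rightarrow> int \<Rightarrow> int \<Rightarrow> int" where
  "entry a b i j = (i\<^sup>2 + a * i * j + b * j\<^sup>2) ^ (p - 2)"

lemma D_mat_eq: "D_mat p a b = umat (\<lambda>(i, j). entry a b (int (i + 1)) (int (j + 1)))"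
  unfolding D_mat_def entry_def by simp

lemma entry_cong:
  assumes "a \<equiv>\<^sub>p a'" "b \<equiv>\<^sub>p b'" "i \<equiv>\<^sub>p i'" "j \<equiv>\<^sub>p j'"
  shows "entry a b i j \<equiv>\<^sub>p entry a' b' i' j'"
  unfolding entry_def by (intro cong_pow cong_add cong_mult assms)

definition S :: "int \<Rightarrow> nat \<Rightarrow> int" where
  "S c n = (\<Sum>x\<in>units. x ^ n * entry c 1 x 1)"

text \<open>Conjugating by the characters diagonalises the matrix: with \<open>i = j * x\<close>
  each double sum splits into a sum over \<open>j\<close>, given by orthogonality, and a sum over
  \<open>x\<close>, which is an \<open>S\<close>. The squared product on the left comes from scaling
  by \<open>j\<^sup>2\<close>.\<close>

lemma det_D_mat: "(\<Prod>x\<in>units. x)\<^sup>2 * det (D_mat p c 1) \<equiv>\<^sub>p (\<Prod>n = 1..p - 1. S c n)"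
proof -
  \<comment> \<open>This is \<open>power_mat\<close> with the row of each unit \<open>j\<close>
    multiplied by \<open>j\<^sup>2\<close>. The factor compensates the
    \<open>j ^ (2 * (p - 2))\<close>, that is \<open>1 / j\<^sup>2\<close>, which homogeneity
    extracts from the entry.\<close>
  define U where "U = umat (\<lambda>(j, l). int (j + 1) ^ (l + 2))"
  have c: "D_mat p c 1 \<in> carrier_mat (p - 1) (p - 1)" "U \<in> carrier_mat (p - 1) (p - 1)"
    "inv_power_mat \<in> carrier_mat (p - 1) (p - 1)" "power_mat \<in> carrier_mat (p - 1) (p - 1)"
    by (simp_all add: D_mat_eq U_def inv_power_mat_def power_mat_def)
  have "U = umat (\<lambda>(i, j). if i = j then (int (i + 1))\<^sup>2 else 0) * power_mat"
    unfolding U_def power_mat_def mult_mat_mat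
    by (rule eq_matI) (auto simp: power_add power2_eq_square if_distrib[of "\<lambda>x. x * _"] sum.delta cong: if_cong)
  hence "det U = (\<Prod>i = 0..<p - 1. (int (i + 1))\<^sup>2) * det power_mat"
    by (simp only: det_mult[OF mat_carrier c(4)] det_diag)
  also have "(\<Prod>i = 0..<p - 1. (int (i + 1))\<^sup>2) = (\<Prod>x\<in>units. x)\<^sup>2"
    by (subst prod_units) (rule prod_power_distrib[symmetric])
  finally have detU: "det U = (\<Prod>x\<in>units. x)\<^sup>2 * det power_mat" .
  have "det (inv_power_mat * (D_mat p c 1 * U))
      \<equiv>\<^sub>p det (umat (\<lambda>(k, l). if k = l then - S c (p - 1 - k) else 0))"
  proof (rule det_cong)
    fix k l assume kl: "k < p - 1" "l < p - 1"
    define G where "G i j = i ^ (p - 1 - k) * (entry c 1 i j * j ^ (l + 2))" for i j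
    have "(inv_power_mat * (D_mat p c 1 * U)) $$ (k, l)
        = (\<Sum>i = 0..<p - 1. int (i + 1) ^ (p - 1 - k) * (\<Sum>j = 0..<p - 1.
            entry c 1 (int (i + 1)) (int (j + 1)) * int (j + 1) ^ (l + 2)))"
      unfolding inv_power_mat_def D_mat_eq U_def mult_mat_mat
      using kl by (simp del: of_nat_add of_nat_Suc)
    also have "\<dots> = (\<Sum>i\<in>units. i ^ (p - 1 - k) * (\<Sum>j\<in>units. entry c 1 i j * j ^ (l + 2)))"
      unfolding sum_units[of "\<lambda>j. entry c 1 _ j * j ^ (l + 2)"]
      by (rule sum_units[of "\<lambda>i. i ^ (p - 1 - k) * (\<Sum>j\<in>units. entry c 1 i j * j ^ (l + 2))"])
    also have "\<dots> = (\<Sum>j\<in>units. \<Sum>i\<in>units. G i j)"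
      by (subst sum.swap) (simp add: sum_distrib_left G_def)
    \<comment> \<open>For each fixed \<open>j\<close>, the substitution \<open>i = j * x\<close>
      permutes the units.\<close>
    also have "\<dots> \<equiv>\<^sub>p (\<Sum>j\<in>units. \<Sum>x\<in>units. G (j * x) j)"
    proof (rule cong_sum, rule cong_sym)
      fix j assume j: "j \<in> units"
      show "(\<Sum>x\<in>units. G (j * x) j) \<equiv>\<^sub>p (\<Sum>x\<in>units. G x j)"
        by (rule sum_units_scale[where F = "\<lambda>x. G x j"])
          (use not_dvd_unit[OF j] in \<open>auto simp: G_def intro!: cong_mult cong_pow entry_cong\<close>)
    qed
    also have "(\<Sum>j\<in>units. \<Sum>x\<in>units. G (j * x) j)
        = (\<Sum>j\<in>units. j ^ (p - 1 - k + l + (p - 1) * 2)) * S c (p - 1 - k)"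
    proof -
      have "G (j * x) j = j ^ (p - 1 - k + l + (p - 1) * 2) * (x ^ (p - 1 - k) * entry c 1 x 1)" for j x
      proof -
        have "entry c 1 (j * x) j = (j\<^sup>2 * (x\<^sup>2 + c * x * 1 + 1 * 1\<^sup>2)) ^ (p - 2)"
          unfolding entry_def by (rule arg_cong[where f = "\<lambda>y. y ^ (p - 2)"])
            (simp add: power2_eq_square algebra_simps)
        also have "\<dots> = j ^ (2 * (p - 2)) * entry c 1 x 1"
          unfolding entry_def by (simp only: power_mult_distrib power_mult)
        finally have "G (j * x) j = j ^ (p - 1 - k + 2 * (p - 2) + (l + 2)) * (x ^ (p - 1 - k) * entry c 1 x 1)"
          unfolding G_def by (simp only: power_mult_distrib power_add mult_ac)
        also have "p - 1 - k + 2 * (p - 2) + (l + 2) = p - 1 - k + l + (p - 1) * 2"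
          using p_gt_2 by simp
        finally show ?thesis .
      qed
      thus ?thesis by (simp add: S_def sum_product)
    qed
    also have "\<dots> \<equiv>\<^sub>p (if k = l then -1 else 0) * S c (p - 1 - k)"
      by (intro cong_mult cong_refl sum_powers_delta kl)
    finally show "(inv_power_mat * (D_mat p c 1 * U)) $$ (k, l)
        \<equiv>\<^sub>p umat (\<lambda>(k, l). if k = l then - S c (p - 1 - k) else 0) $$ (k, l)"
      using kl by (cases "k = l") simp_all
  qed (rule mult_carrier_mat[OF c(3) mult_carrier_mat[OF c(1,2)]], rule mat_carrier)
  also have "det (umat (\<lambda>(k, l). if k = l then - S c (p - 1 - k) else 0)) = (\<Prod>n = 1..p - 1. S c n)"
  proof -
    have "det (umat (\<lambda>(k, l). if k = l then - S c (p - 1 - k) else 0))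
        = (\<Prod>k = 0..<p - 1. - S c (p - 1 - k))"
      by (rule det_diag)
    \<comment> \<open>An even number of factors changes sign.\<close>
    also have "\<dots> = (\<Prod>k = 0..<p - 1. S c (p - 1 - k))"
      using odd by (subst prod_uminus) simp
    also have "\<dots> = (\<Prod>n = 1..p - 1. S c n)"
      by (rule prod.reindex_bij_witness[of _ "\<lambda>n. p - 1 - n" "\<lambda>n. p - 1 - n"]) auto
    finally show ?thesis .
  qed
  finally have "det (inv_power_mat * (D_mat p c 1 * U)) \<equiv>\<^sub>p (\<Prod>n = 1..p - 1. S c n)" .
  also have "det (inv_power_mat * (D_mat p c 1 * U))
      = (det inv_power_mat * det power_mat) * ((\<Prod>x\<in>units. x)\<^sup>2 * det (D_mat p c 1))"
    by (simp only: det_mult[OF c(3) mult_carrier_mat[OF c(1,2)]] det_mult[OF c(1,2)] detU mult_ac)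
  finally have *: "(det inv_power_mat * det power_mat) * ((\<Prod>x\<in>units. x)\<^sup>2 * det (D_mat p c 1))
      \<equiv>\<^sub>p (\<Prod>n = 1..p - 1. S c n)" .
  have "1 * ((\<Prod>x\<in>units. x)\<^sup>2 * det (D_mat p c 1))
      \<equiv>\<^sub>p (det inv_power_mat * det power_mat) * ((\<Prod>x\<in>units. x)\<^sup>2 * det (D_mat p c 1))"
    by (intro cong_mult cong_refl cong_sym[OF det_inv_power_mat])
  from cong_trans[OF this *] show ?thesis by simp
qed

text \<open>Modulo \<open>p\<close> the form is
  \<open>i\<^sup>2 + (c * d') * i * (d * j) + (d * j)\<^sup>2\<close>, so the columns are those of
  \<open>D_mat p (c * d') 1\<close> in another order. Multiplying by powers of \<open>d * j\<close>
  on one side and of \<open>j\<close> on the other makes the products agree, so the sign of the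
  permutation enters only through a power of \<open>d\<close>, once the Vandermonde determinant is
  cancelled.\<close>

lemma L_det_D_mat_square:
  assumes d: "\<not> int p dvd d" and d': "d * d' \<equiv>\<^sub>p 1"
  shows "L (det (D_mat p c (d\<^sup>2))) = L d ^ h * L (det (D_mat p (c * d') 1))"
proof -
  define U where "U = umat (\<lambda>(j, l). (d * int (j + 1)) ^ l)"
  have c: "D_mat p a b \<in> carrier_mat (p - 1) (p - 1)" "U \<in> carrier_mat (p - 1) (p - 1)"
    "power_mat \<in> carrier_mat (p - 1) (p - 1)" for a b
    by (simp_all add: D_mat_eq U_def power_mat_def)
  have "U = power_mat * umat (\<lambda>(i, j). if i = j then d ^ i else 0)"
    unfolding U_def power_mat_def mult_mat_mat
    by (rule eq_matI) (auto simp: power_mult_distrib if_distrib[of "\<lambda>x. _ * x"] sum.delta cong: if_cong)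
  hence "det U = det power_mat * (\<Prod>l = 0..<p - 1. d ^ l)"
    by (simp only: det_mult[OF c(3) mat_carrier] det_diag)
  \<comment> \<open>The exponents \<open>0, ..., p - 2\<close> add up to
    \<open>(p - 2) * (p - 1) / 2\<close>.\<close>
  also have "(\<Prod>l = 0..<p - 1. d ^ l) = d ^ (h * (p - 2))"
  proof -
    have "(\<Prod>l = 0..<p - 1. d ^ l) = d ^ (\<Sum>l = 0..<p - 1. l)"
      by (simp add: power_sum)
    also have "(\<Sum>l = 0..<p - 1. l) = (p - 2) * (p - 1) div 2"
      using gauss_sum_nat[of "p - 2"] unfolding p_minus_1
      by (simp add: atLeast0LessThan atLeast0AtMost lessThan_Suc_atMost)
    also have "\<dots> = h * (p - 2)"
      using div_mult_swap[of 2 "p - 1" "p - 2"] odd by (simp add: mult.commute)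
    finally show ?thesis .
  qed
  finally have detU: "det U = det power_mat * d ^ (h * (p - 2))" .
  have "det (D_mat p c (d\<^sup>2) * U) \<equiv>\<^sub>p det (D_mat p (c * d') 1 * power_mat)"
  proof (rule det_cong)
    fix i l assume il: "i < p - 1" "l < p - 1"
    define x where "x = int (i + 1)"
    have "(D_mat p c (d\<^sup>2) * U) $$ (i, l)
        = (\<Sum>j = 0..<p - 1. entry c (d\<^sup>2) x (int (j + 1)) * (d * int (j + 1)) ^ l)"
      unfolding D_mat_eq U_def mult_mat_mat x_def using il by (simp del: of_nat_add of_nat_Suc)
    also have "\<dots> = (\<Sum>j\<in>units. entry c (d\<^sup>2) x j * (d * j) ^ l)"
      by (rule sum_units)
    also have "\<dots> \<equiv>\<^sub>p (\<Sum>j\<in>units. entry (c * d') 1 x (d * j) * (d * j) ^ l)"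
    proof (intro cong_sum cong_mult cong_refl)
      fix j
      have "c * x * j * 1 \<equiv>\<^sub>p c * x * j * (d * d')"
        by (intro cong_mult cong_sym[OF d'] cong_refl)
      hence "x\<^sup>2 + c * x * j * 1 + d\<^sup>2 * j\<^sup>2 \<equiv>\<^sub>p x\<^sup>2 + c * x * j * (d * d') + d\<^sup>2 * j\<^sup>2"
        by (intro cong_add cong_refl)
      thus "entry c (d\<^sup>2) x j \<equiv>\<^sub>p entry (c * d') 1 x (d * j)"
        unfolding entry_def by (intro cong_pow) (simp add: power_mult_distrib mult_ac)
    qed
    also have "(\<Sum>j\<in>units. entry (c * d') 1 x (d * j) * (d * j) ^ l)
        \<equiv>\<^sub>p (\<Sum>j\<in>units. entry (c * d') 1 x j * j ^ l)"
      by (rule sum_units_scale[where F = "\<lambda>j. entry (c * d') 1 x j * j ^ l"])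
        (auto intro!: cong_mult entry_cong cong_pow d)
    also have "(\<Sum>j\<in>units. entry (c * d') 1 x j * j ^ l) = (D_mat p (c * d') 1 * power_mat) $$ (i, l)"
      unfolding D_mat_eq power_mat_def mult_mat_mat
      using il by (subst sum_units[symmetric]) (simp add: x_def)
    finally show "(D_mat p c (d\<^sup>2) * U) $$ (i, l) \<equiv>\<^sub>p (D_mat p (c * d') 1 * power_mat) $$ (i, l)" .
  qed (rule mult_carrier_mat[OF c(1,2)] mult_carrier_mat[OF c(1,3)])+
  hence "det power_mat * (det (D_mat p c (d\<^sup>2)) * d ^ (h * (p - 2)))
      \<equiv>\<^sub>p det power_mat * det (D_mat p (c * d') 1)"
    by (simp only: det_mult[OF c(1,2)] det_mult[OF c(1,3)] detU mult_ac)
  hence "L (det (D_mat p c (d\<^sup>2)) * d ^ (h * (p - 2))) = L (det (D_mat p (c * d') 1))"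
    by (rule L_cong[OF cong_cancel[OF _ not_dvd_det_power_mat]])
  hence "L (det (D_mat p c (d\<^sup>2))) * L d ^ (h * (p - 2)) = L (det (D_mat p (c * d') 1))"
    by (simp add: L_mult L_power)
  \<comment> \<open>Here \<open>L d\<close> is a sign and \<open>p - 2\<close> is odd.\<close>
  moreover have "L d ^ (h * (p - 2)) = L d ^ h"
  proof -
    have "Parity.odd (p - 2)" using odd p_gt_2 by simp
    hence "L d ^ (p - 2) = L d"
      using L_values[of d] d L_0_iff[of d] by auto
    thus ?thesis by (simp only: mult.commute[of h] power_mult)
  qed
  \<comment> \<open>Being its own inverse, the sign can be moved to the other side.\<close>
  moreover have "L d ^ h * L d ^ h = 1"
    using L_square[OF d] by (simp flip: power_mult_distrib)
  ultimately show ?thesis by (metis mult.assoc mult.commute mult.right_neutral)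
qed

subsection \<open>Sums over \<open>x + 1 / x\<close>\<close>

lemma card_sqrt_mod: "int (card {y \<in> res. y\<^sup>2 \<equiv>\<^sub>p a}) = 1 + L a"
proof (cases "int p dvd a")
  case True
  have "y\<^sup>2 \<equiv>\<^sub>p a \<longleftrightarrow> y = 0" if "y \<in> res" for y
  proof
    assume "y\<^sup>2 \<equiv>\<^sub>p a"
    hence "int p dvd y\<^sup>2" using True cong_dvd_iff by blast
    hence "int p dvd y" using prime_dvd_power[OF prime_int] by blast
    thus "y = 0" using that by (auto dest: zdvd_imp_le)
  next
    assume "y = 0"
    thus "y\<^sup>2 \<equiv>\<^sub>p a" using True by (simp add: cong_iff_dvd_diff)
  qed
  hence "{y \<in> res. y\<^sup>2 \<equiv>\<^sub>p a} = {y \<in> res. y = 0}" by blast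
  also have "\<dots> = {0}" using p_gt_2 by auto
  finally have "{y \<in> res. y\<^sup>2 \<equiv>\<^sub>p a} = {0}" .
  thus ?thesis using True L_0_iff[of a] by simp
next
  case False
  show ?thesis
  proof (cases "QuadRes (int p) a")
    case True
    then obtain z where z: "z\<^sup>2 \<equiv>\<^sub>p a" unfolding QuadRes_def by blast
    have nz: "\<not> int p dvd z"
    proof
      assume "int p dvd z"
      hence "int p dvd z\<^sup>2" by (simp add: power2_eq_square)
      thus False using cong_dvd_iff[OF z] False by blast
    qed
    have "y\<^sup>2 \<equiv>\<^sub>p a \<longleftrightarrow> y = z mod int p \<or> y = (- z) mod int p" if y: "y \<in> res" for y
    proof -
      have "y\<^sup>2 \<equiv>\<^sub>p a \<longleftrightarrow> y\<^sup>2 \<equiv>\<^sub>p z\<^sup>2"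
        using z by (meson cong_sym cong_trans)
      also have "\<dots> \<longleftrightarrow> int p dvd (y - z) * (y - (- z))"
        by (simp add: cong_iff_dvd_diff power2_eq_square algebra_simps)
      also have "\<dots> \<longleftrightarrow> y \<equiv>\<^sub>p z \<or> y \<equiv>\<^sub>p - z"
        unfolding prime_dvd_mult_iff[OF prime_int] cong_iff_dvd_diff ..
      finally show ?thesis using y by (simp add: cong_def)
    qed
    hence "{y \<in> res. y\<^sup>2 \<equiv>\<^sub>p a} = {z mod int p, (- z) mod int p}" using p_gt_2 by auto
    moreover have "z mod int p \<noteq> (- z) mod int p"
    proof
      assume "z mod int p = (- z) mod int p"
      hence "int p dvd z - (- z)" by (simp add: mod_eq_dvd_iff)
      hence "int p dvd 2 * z" by simp
      thus False using not_dvd_mult[OF not_dvd_2 nz] by blast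
    qed
    ultimately show ?thesis using True False by (simp add: Legendre_def cong_0_iff)
  next
    case nonres: False
    hence e: "{y \<in> res. y\<^sup>2 \<equiv>\<^sub>p a} = {}" by (auto simp: QuadRes_def)
    show ?thesis unfolding e using nonres False by (simp add: Legendre_def cong_0_iff)
  qed
qed

text \<open>Multiplying \<open>x + 1 / x = u\<close> by \<open>4 * x\<close> and completing the
  square gives \<open>(2 * x - u)\<^sup>2 = u\<^sup>2 - 4\<close>, so the solutions correspond to
  square roots of \<open>u\<^sup>2 - 4\<close>. Euler's criterion then makes the count a polynomial
  in \<open>u\<close> modulo \<open>p\<close>.\<close>

lemma card_sum_inverse_eq:
  assumes u: "u \<in> res"
  shows "int (card {x \<in> units. (x + x ^ (p - 2)) mod int p = u}) \<equiv>\<^sub>p 1 + (u\<^sup>2 - 4) ^ h"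
proof -
  define F :: "int \<Rightarrow> int" where "F y = (if y\<^sup>2 \<equiv>\<^sub>p u\<^sup>2 - 4 then 1 else 0)" for y
  have "(x + x ^ (p - 2)) mod int p = u \<longleftrightarrow> (2 * x - u)\<^sup>2 \<equiv>\<^sub>p u\<^sup>2 - 4" if x: "x \<in> units" for x
  proof -
    have "(x + x ^ (p - 2)) mod int p = u \<longleftrightarrow> x + x ^ (p - 2) \<equiv>\<^sub>p u"
      using u by (simp add: cong_def)
    also have "\<dots> \<longleftrightarrow> x * (x + x ^ (p - 2)) \<equiv>\<^sub>p x * u"
      by (rule cong_cancel_iff[OF not_dvd_unit[OF x], symmetric])
    also have "\<dots> \<longleftrightarrow> x * x + 1 \<equiv>\<^sub>p x * u"
      using cong_add[OF cong_refl unit_inverse[OF not_dvd_unit[OF x]], of "x * x"]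
      unfolding distrib_left by (meson cong_sym cong_trans)
    also have "\<dots> \<longleftrightarrow> 4 * (x * x + 1) \<equiv>\<^sub>p 4 * (x * u)"
      by (rule cong_cancel_iff[OF not_dvd_4, symmetric])
    also have "\<dots> \<longleftrightarrow> (2 * x - u)\<^sup>2 \<equiv>\<^sub>p u\<^sup>2 - 4"
      by (simp add: cong_iff_dvd_diff power2_eq_square algebra_simps)
    finally show ?thesis .
  qed
  \<comment> \<open>The value \<open>x = 0\<close> is never a solution, so the count may run over
    all residues, where \<open>x \<mapsto> 2 * x - u\<close> is a bijection.\<close>
  moreover have "\<not> (2 * 0 - u)\<^sup>2 \<equiv>\<^sub>p u\<^sup>2 - 4"
    using not_dvd_4 by (simp add: cong_iff_dvd_diff)
  moreover have "res = insert 0 units" using p_gt_2 by auto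
  ultimately have "{x \<in> units. (x + x ^ (p - 2)) mod int p = u} = {x \<in> res. (2 * x - u)\<^sup>2 \<equiv>\<^sub>p u\<^sup>2 - 4}"
    by auto
  hence "int (card {x \<in> units. (x + x ^ (p - 2)) mod int p = u}) = (\<Sum>x\<in>res. F (2 * x - u))"
    by (simp add: F_def sum.If_cases Int_def)
  also have "\<dots> \<equiv>\<^sub>p (\<Sum>x\<in>res. F x)"
  proof (rule sum_reindex_mod[where F = F and g = "\<lambda>x. 2 * x - u"])
    fix x y assume "x \<equiv>\<^sub>p y"
    hence "x\<^sup>2 \<equiv>\<^sub>p y\<^sup>2" by (rule cong_pow)
    hence "x\<^sup>2 \<equiv>\<^sub>p u\<^sup>2 - 4 \<longleftrightarrow> y\<^sup>2 \<equiv>\<^sub>p u\<^sup>2 - 4" by (meson cong_sym cong_trans)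
    thus "F x \<equiv>\<^sub>p F y" by (simp add: F_def)
  next
    fix x y assume "2 * x - u \<equiv>\<^sub>p 2 * y - u"
    hence "2 * x \<equiv>\<^sub>p 2 * y" by (simp add: cong_iff_dvd_diff)
    thus "x \<equiv>\<^sub>p y" using not_dvd_2 by (rule cong_cancel)
  qed (use p_gt_2 in auto)
  also have "(\<Sum>x\<in>res. F x) = int (card {y \<in> res. y\<^sup>2 \<equiv>\<^sub>p u\<^sup>2 - 4})"
    by (simp add: F_def sum.If_cases Int_def)
  also have "\<dots> = 1 + L (u\<^sup>2 - 4)" by (rule card_sqrt_mod)
  also have "\<dots> \<equiv>\<^sub>p 1 + (u\<^sup>2 - 4) ^ h" by (intro cong_add cong_refl euler)
  finally show ?thesis .
qed

lemma sum_unit_plus_inverse: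
  assumes per: "\<And>x y. x \<equiv>\<^sub>p y \<Longrightarrow> F x \<equiv>\<^sub>p F y"
  shows "(\<Sum>x\<in>units. F (x + x ^ (p - 2))) \<equiv>\<^sub>p (\<Sum>u\<in>res. (1 + (u\<^sup>2 - 4) ^ h) * F u)"
proof -
  define g where "g x = (x + x ^ (p - 2)) mod int p" for x
  have "(\<Sum>x\<in>units. F (x + x ^ (p - 2))) \<equiv>\<^sub>p (\<Sum>x\<in>units. F (g x))"
    by (intro cong_sum per) (simp add: g_def cong_def)
  \<comment> \<open>The units are grouped into fibres of
    \<open>x \<mapsto> x + 1 / x\<close>.\<close>
  also have "(\<Sum>x\<in>units. F (g x)) = (\<Sum>u\<in>res. \<Sum>x\<in>{x \<in> units. g x = u}. F (g x))"
    by (rule sum.group[symmetric]) (use p_gt_2 in \<open>auto simp: g_def\<close>)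
  also have "\<dots> = (\<Sum>u\<in>res. int (card {x \<in> units. g x = u}) * F u)"
    by (intro sum.cong) auto
  also have "\<dots> \<equiv>\<^sub>p (\<Sum>u\<in>res. (1 + (u\<^sup>2 - 4) ^ h) * F u)"
    by (intro cong_sum cong_mult cong_refl) (simp only: g_def card_sum_inverse_eq)
  finally show ?thesis .
qed

section \<open>Evaluation of the two unpaired eigenvalues\<close>

text \<open>Since \<open>x\<^sup>2 + c * x + 1 = x * (x + 1 / x + c)\<close>, the power
  \<open>p - 2\<close> of the extracted \<open>x\<close> cancels one factor of
  \<open>x ^ Suc n\<close>.\<close>

lemma S_eq:
  "S c (Suc n) \<equiv>\<^sub>p (\<Sum>x\<in>units. x ^ n * (x + x ^ (p - 2) + c) ^ (p - 2))"
  unfolding S_def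
proof (rule cong_sum)
  fix x assume x: "x \<in> units"
  note inv = unit_inverse[OF not_dvd_unit[OF x]]
  have "x\<^sup>2 + c * x * 1 + 1 * 1\<^sup>2 = x * (x + c) + 1"
    by (simp add: power2_eq_square algebra_simps)
  also have "\<dots> \<equiv>\<^sub>p x * (x + c) + x * x ^ (p - 2)"
    by (intro cong_add cong_refl cong_sym[OF inv])
  also have "x * (x + c) + x * x ^ (p - 2) = x * (x + x ^ (p - 2) + c)"
    by (simp add: algebra_simps)
  finally have "entry c 1 x 1 \<equiv>\<^sub>p (x * (x + x ^ (p - 2) + c)) ^ (p - 2)"
    unfolding entry_def by (rule cong_pow)
  hence "x ^ Suc n * entry c 1 x 1 \<equiv>\<^sub>p x ^ Suc n * (x * (x + x ^ (p - 2) + c)) ^ (p - 2)"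
    by (intro cong_mult cong_refl)
  also have "x ^ Suc n * (x * (x + x ^ (p - 2) + c)) ^ (p - 2)
      = x * x ^ (p - 2) * (x ^ n * (x + x ^ (p - 2) + c) ^ (p - 2))"
    by (simp only: power_mult_distrib power_Suc mult_ac)
  also have "\<dots> \<equiv>\<^sub>p 1 * (x ^ n * (x + x ^ (p - 2) + c) ^ (p - 2))"
    by (intro cong_mult inv cong_refl)
  finally show "x ^ Suc n * entry c 1 x 1 \<equiv>\<^sub>p x ^ n * (x + x ^ (p - 2) + c) ^ (p - 2)"
    by simp
qed

lemma sum_poly_shifted_power:
  fixes P :: "int poly"
  assumes "degree P \<le> p - 1"
  shows "(\<Sum>u\<in>res. poly P (u + c) * (u + c) ^ (p - 2)) \<equiv>\<^sub>p - poly (pderiv P) 0"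
proof -
  have "(\<Sum>u\<in>res. poly P (u + c) * (u + c) ^ (p - 2)) \<equiv>\<^sub>p (\<Sum>v\<in>res. poly P v * v ^ (p - 2))"
    by (rule sum_residues_shift[where F = "\<lambda>v. poly P v * v ^ (p - 2)"])
      (intro cong_mult cong_pow poly_cong)
  from cong_trans[OF this sum_poly_power[OF assms]] show ?thesis .
qed

text \<open>The derivative at 0 contains \<open>(c\<^sup>2 - 4) ^ (h - 1)\<close>. The factor
  \<open>c\<^sup>2 - 4\<close> on the left completes this to the power \<open>h\<close>, which is a
  Legendre symbol.\<close>

lemma S_one: "(c\<^sup>2 - 4) * S c 1 \<equiv>\<^sub>p - c * L (c\<^sup>2 - 4)"
proof -
  \<comment> \<open>The weight \<open>1 + (u\<^sup>2 - 4) ^ h\<close> as a polynomial in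
    \<open>v = u + c\<close>, because
    \<open>(v - c)\<^sup>2 - 4 = v\<^sup>2 - 2 * c * v + c\<^sup>2 - 4\<close>.\<close>
  define P where "P = 1 + [:c\<^sup>2 - 4, - 2 * c, 1:] ^ h"
  have "degree P \<le> 2 * h"
    unfolding P_def by (rule degree_add_le) (auto intro: order_trans[OF degree_power_le])
  hence deg: "degree P \<le> p - 1" by (simp only: two_h)
  have "S c 1 \<equiv>\<^sub>p (\<Sum>x\<in>units. (x + x ^ (p - 2) + c) ^ (p - 2))"
    using S_eq[of c 0] by simp
  also have "(\<Sum>x\<in>units. (x + x ^ (p - 2) + c) ^ (p - 2))
      \<equiv>\<^sub>p (\<Sum>u\<in>res. (1 + (u\<^sup>2 - 4) ^ h) * (u + c) ^ (p - 2))"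
    by (rule sum_unit_plus_inverse) (intro cong_pow cong_add cong_refl)
  also have "(\<Sum>u\<in>res. (1 + (u\<^sup>2 - 4) ^ h) * (u + c) ^ (p - 2))
      = (\<Sum>u\<in>res. poly P (u + c) * (u + c) ^ (p - 2))"
  proof (rule sum.cong)
    fix u
    have "c\<^sup>2 - 4 + (u + c) * (- 2 * c + (u + c) * 1) = u\<^sup>2 - 4"
      by (simp add: power2_eq_square algebra_simps)
    thus "(1 + (u\<^sup>2 - 4) ^ h) * (u + c) ^ (p - 2) = poly P (u + c) * (u + c) ^ (p - 2)"
      by (simp only: P_def poly_add poly_1 poly_power poly_pCons poly_0 mult_zero_right add_0_right)
  qed simp
  also have "\<dots> \<equiv>\<^sub>p - poly (pderiv P) 0"
    by (rule sum_poly_shifted_power[OF deg])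
  also have "- poly (pderiv P) 0 = 2 * int h * (c * (c\<^sup>2 - 4) ^ (h - 1))"
    by (simp add: P_def pderiv_add pderiv_power pderiv_pCons)
  \<comment> \<open>The factor \<open>2 * h = p - 1\<close> is -1 modulo \<open>p\<close>.\<close>
  also have "\<dots> \<equiv>\<^sub>p (-1) * (c * (c\<^sup>2 - 4) ^ (h - 1))"
    unfolding two_int_h by (intro cong_mult cong_refl) (simp add: cong_iff_dvd_diff)
  finally have "(c\<^sup>2 - 4) * S c 1 \<equiv>\<^sub>p (c\<^sup>2 - 4) * ((-1) * (c * (c\<^sup>2 - 4) ^ (h - 1)))"
    by (intro cong_mult cong_refl)
  also have "(c\<^sup>2 - 4) * ((-1) * (c * (c\<^sup>2 - 4) ^ (h - 1))) = - c * (c\<^sup>2 - 4) ^ h"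
    using power_minus_mult[OF h_pos, of "c\<^sup>2 - 4"] by (simp add: mult_ac)
  also have "\<dots> \<equiv>\<^sub>p - c * L (c\<^sup>2 - 4)"
    by (intro cong_mult cong_refl cong_sym[OF euler])
  finally show ?thesis .
qed

text \<open>With \<open>u = x + 1 / x\<close>, the identity
  \<open>x * (u + 2) = (x + 1)\<^sup>2\<close> gives \<open>x ^ h * (u + 2) ^ h = 1\<close> unless
  \<open>x = -1\<close>, and \<open>x ^ h\<close> is its own inverse. At \<open>x = -1\<close> the
  power of \<open>u + 2\<close> vanishes, so the value \<open>(-1) ^ h\<close> is added by
  hand.\<close>

lemma unit_power_h:
  assumes x: "x \<in> units"
  shows "x ^ h \<equiv>\<^sub>p (x + x ^ (p - 2) + 2) ^ h + (if x = int p - 1 then (-1) ^ h else 0)"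
proof (cases "x = int p - 1")
  case True
  have x1: "x \<equiv>\<^sub>p -1" unfolding True by (simp add: cong_iff_dvd_diff)
  have "Parity.odd (p - 2)" using odd p_gt_2 by simp
  hence "x + x ^ (p - 2) + 2 \<equiv>\<^sub>p 0"
    using cong_add[OF cong_add[OF x1 cong_pow[OF x1, of "p - 2"]] cong_refl[of 2]] by simp
  hence "(x + x ^ (p - 2) + 2) ^ h + (-1) ^ h \<equiv>\<^sub>p 0 ^ h + (-1) ^ h"
    by (intro cong_add cong_pow cong_refl)
  hence "(x + x ^ (p - 2) + 2) ^ h + (-1) ^ h \<equiv>\<^sub>p (-1) ^ h"
    by (simp only: zero_power[OF h_pos] add_0)
  hence "x ^ h \<equiv>\<^sub>p (x + x ^ (p - 2) + 2) ^ h + (-1) ^ h"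
    using cong_pow[OF x1, of h] by (meson cong_sym cong_trans)
  thus ?thesis unfolding if_P[OF True] .
next
  case False
  note inv = unit_inverse[OF not_dvd_unit[OF x]]
  have "\<not> int p dvd x + 1"
    using x False by (auto dest: zdvd_imp_le)
  hence "1 \<equiv>\<^sub>p ((x + 1)\<^sup>2) ^ h"
    using cong_sym[OF power_2h] unfolding power_mult by blast
  also have "(x + 1)\<^sup>2 = x * (x + 2) + 1"
    by (simp add: power2_eq_square algebra_simps)
  also have "(x * (x + 2) + 1) ^ h \<equiv>\<^sub>p (x * (x + 2) + x * x ^ (p - 2)) ^ h"
    by (intro cong_pow cong_add cong_refl cong_sym[OF inv])
  also have "x * (x + 2) + x * x ^ (p - 2) = x * (x + x ^ (p - 2) + 2)"
    by (simp add: algebra_simps)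
  finally have "x ^ h * 1 \<equiv>\<^sub>p x ^ h * (x * (x + x ^ (p - 2) + 2)) ^ h"
    by (intro cong_mult cong_refl)
  also have "x ^ h * (x * (x + x ^ (p - 2) + 2)) ^ h = x ^ (2 * h) * (x + x ^ (p - 2) + 2) ^ h"
    by (simp only: power_mult_distrib mult_2 power_add mult_ac)
  also have "\<dots> \<equiv>\<^sub>p 1 * (x + x ^ (p - 2) + 2) ^ h"
    by (intro cong_mult cong_refl power_2h not_dvd_unit x)
  finally have "x ^ h \<equiv>\<^sub>p (x + x ^ (p - 2) + 2) ^ h" by simp
  thus ?thesis using False by simp
qed

text \<open>Factoring \<open>u\<^sup>2 - 4\<close> gives \<open>(u\<^sup>2 - 4) ^ h * (u + 2) ^ h =
  (u - 2) ^ h * (u + 2) ^ (2 * h)\<close>, where the last factor is 1 unless \<open>u = -2\<close>.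
  There the product is 0 while \<open>(u - 2) ^ h = (-4) ^ h = (-1) ^ h\<close>: exactly the
  correction coming from \<open>x = -1\<close>.\<close>

lemma twisted_weight:
  assumes u: "u \<in> res"
  shows "(1 + (u\<^sup>2 - 4) ^ h) * (u + 2) ^ h + (if u = int p - 2 then (-1) ^ h else 0)
    \<equiv>\<^sub>p (u + 2) ^ h + (u - 2) ^ h"
proof (cases "u = int p - 2")
  case True
  have u2: "u \<equiv>\<^sub>p -2" unfolding True by (simp add: cong_iff_dvd_diff)
  have "(u + 2) ^ h \<equiv>\<^sub>p (- 2 + 2) ^ h"
    by (intro cong_pow cong_add u2 cong_refl)
  hence z: "(u + 2) ^ h \<equiv>\<^sub>p 0"
    by (simp only: add.left_inverse zero_power[OF h_pos])
  have "(u - 2) ^ h \<equiv>\<^sub>p (- 2 - 2) ^ h"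
    by (intro cong_pow cong_diff u2 cong_refl)
  also have "(- 2 - 2 :: int) ^ h = (-1) ^ h * 2 ^ (2 * h)"
    by (simp only: power_mult flip: power_mult_distrib) simp
  also have "\<dots> \<equiv>\<^sub>p (-1) ^ h * 1"
    by (intro cong_mult cong_refl power_2h not_dvd_2)
  finally have w: "(u - 2) ^ h \<equiv>\<^sub>p (-1) ^ h" by simp
  have "(1 + (u\<^sup>2 - 4) ^ h) * (u + 2) ^ h + (-1) ^ h \<equiv>\<^sub>p (1 + (u\<^sup>2 - 4) ^ h) * 0 + (-1) ^ h"
    by (intro cong_add cong_mult cong_refl z)
  moreover have "(u + 2) ^ h + (u - 2) ^ h \<equiv>\<^sub>p 0 + (-1) ^ h"
    by (intro cong_add z w)
  ultimately have "(1 + (u\<^sup>2 - 4) ^ h) * (u + 2) ^ h + (-1) ^ h \<equiv>\<^sub>p (u + 2) ^ h + (u - 2) ^ h"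
    by (simp add: cong_def)
  thus ?thesis unfolding if_P[OF True] .
next
  case False
  have nd: "\<not> int p dvd u + 2"
  proof
    assume "int p dvd u + 2"
    then obtain k where k: "u + 2 = int p * k" by blast
    \<comment> \<open>The number \<open>u + 2\<close> lies between 2 and \<open>p + 1\<close>, so a
      multiple of \<open>p\<close> could only be \<open>p\<close> itself, the excluded case.\<close>
    have "int p * 0 < int p * k" "int p * k < int p * 2"
      using u p_gt_2 unfolding k[symmetric] by auto
    hence "0 < k" "k < 2" using p_gt_2 by (auto simp: mult_less_cancel_left zero_less_mult_iff)
    hence "k = 1" by simp
    thus False using k False by simp
  qed
  have "(1 + (u\<^sup>2 - 4) ^ h) * (u + 2) ^ h = (u + 2) ^ h + (u - 2) ^ h * (u + 2) ^ (2 * h)"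
  proof -
    have "u\<^sup>2 - 4 = (u - 2) * (u + 2)" by (simp add: power2_eq_square algebra_simps)
    thus ?thesis by (simp only: distrib_right mult_1 power_mult_distrib mult_2 power_add mult.assoc)
  qed
  also have "\<dots> \<equiv>\<^sub>p (u + 2) ^ h + (u - 2) ^ h * 1"
    by (intro cong_add cong_mult cong_refl power_2h nd)
  finally show ?thesis using False by simp
qed

text \<open>The two exceptional terms match, so the weight becomes
  \<open>(u + 2) ^ h + (u - 2) ^ h\<close>. Multiplying the resulting derivative by
  \<open>c\<^sup>2 - 4 = (2 - c) * (- 2 - c)\<close> raises both powers from \<open>h - 1\<close> to
  \<open>h\<close>, and the factor 2 turns \<open>- h\<close> into \<open>1 - p\<close>.\<close>

lemma S_half:
  "2 * (c\<^sup>2 - 4) * S c (Suc h) \<equiv>\<^sub>p (- 2 - c) * L (2 - c) + (2 - c) * L (- 2 - c)"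
proof -
  define F where "F u = (u + c) ^ (p - 2)" for u
  have per: "F x \<equiv>\<^sub>p F y" if "x \<equiv>\<^sub>p y" for x y
    unfolding F_def by (intro cong_pow cong_add that cong_refl)
  define G where "G u = (u + 2) ^ h * F u" for u
  have perG: "G x \<equiv>\<^sub>p G y" if "x \<equiv>\<^sub>p y" for x y
    unfolding G_def by (intro cong_mult cong_pow cong_add per that cong_refl)
  \<comment> \<open>The weight \<open>(u + 2) ^ h + (u - 2) ^ h\<close> written in
    \<open>v = u + c\<close>.\<close>
  define P where "P = [:2 - c, 1:] ^ h + [:- 2 - c, 1:] ^ h"
  have "degree P \<le> 2 * h"
    unfolding P_def by (rule degree_add_le) (auto intro: order_trans[OF degree_power_le])
  hence deg: "degree P \<le> p - 1" by (simp only: two_h)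
  \<comment> \<open>The extra contribution of \<open>x = -1\<close>, where
    \<open>x + 1 / x = -2\<close>.\<close>
  define e where "e = (-1) ^ h * F (- 2)"
  have "S c (Suc h) \<equiv>\<^sub>p (\<Sum>x\<in>units. x ^ h * F (x + x ^ (p - 2)))"
    unfolding F_def by (rule S_eq)
  also have "(\<Sum>x\<in>units. x ^ h * F (x + x ^ (p - 2)))
      \<equiv>\<^sub>p (\<Sum>x\<in>units. G (x + x ^ (p - 2)) + (if x = int p - 1 then e else 0))"
  proof (rule cong_sum)
    fix x assume x: "x \<in> units"
    have "x ^ h * F (x + x ^ (p - 2))
        \<equiv>\<^sub>p ((x + x ^ (p - 2) + 2) ^ h + (if x = int p - 1 then (-1) ^ h else 0)) * F (x + x ^ (p - 2))"
      by (intro cong_mult cong_refl unit_power_h x)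
    also have "((x + x ^ (p - 2) + 2) ^ h + (if x = int p - 1 then (-1) ^ h else 0)) * F (x + x ^ (p - 2))
        = G (x + x ^ (p - 2)) + (if x = int p - 1 then (-1) ^ h * F (x + x ^ (p - 2)) else 0)"
      unfolding G_def distrib_right by (cases "x = int p - 1") simp_all
    also have "\<dots> \<equiv>\<^sub>p G (x + x ^ (p - 2)) + (if x = int p - 1 then e else 0)"
    proof (cases "x = int p - 1")
      case True
      have x1: "x \<equiv>\<^sub>p -1" unfolding True by (simp add: cong_iff_dvd_diff)
      have "Parity.odd (p - 2)" using odd p_gt_2 by simp
      hence "x + x ^ (p - 2) \<equiv>\<^sub>p - 2"
        using cong_add[OF x1 cong_pow[OF x1, of "p - 2"]] by simp
      hence "(-1) ^ h * F (x + x ^ (p - 2)) \<equiv>\<^sub>p e"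
        unfolding e_def by (intro cong_mult per cong_refl)
      thus ?thesis unfolding if_P[OF True] by (intro cong_add cong_refl)
    qed simp
    finally show "x ^ h * F (x + x ^ (p - 2))
      \<equiv>\<^sub>p G (x + x ^ (p - 2)) + (if x = int p - 1 then e else 0)" .
  qed
  also have "(\<Sum>x\<in>units. G (x + x ^ (p - 2)) + (if x = int p - 1 then e else 0))
      = (\<Sum>x\<in>units. G (x + x ^ (p - 2))) + e"
    using p_gt_2 by (simp add: sum.distrib)
  also have "\<dots> \<equiv>\<^sub>p (\<Sum>u\<in>res. (1 + (u\<^sup>2 - 4) ^ h) * G u) + e"
    by (rule cong_add[OF sum_unit_plus_inverse[OF perG] cong_refl])
  \<comment> \<open>The extra term is attached to \<open>u = p - 2\<close>, the representative of
    -2.\<close>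
  also have "(\<Sum>u\<in>res. (1 + (u\<^sup>2 - 4) ^ h) * G u) + e
      = (\<Sum>u\<in>res. (1 + (u\<^sup>2 - 4) ^ h) * G u + (if u = int p - 2 then e else 0))"
    using p_gt_2 by (simp add: sum.distrib)
  also have "\<dots> \<equiv>\<^sub>p (\<Sum>u\<in>res. poly P (u + c) * (u + c) ^ (p - 2))"
  proof (rule cong_sum)
    fix u assume u: "u \<in> res"
    have "(if u = int p - 2 then e else 0) \<equiv>\<^sub>p (if u = int p - 2 then (-1) ^ h * F u else 0)"
    proof (cases "u = int p - 2")
      case True
      have "- 2 \<equiv>\<^sub>p u" unfolding True by (simp add: cong_iff_dvd_diff)
      hence "e \<equiv>\<^sub>p (-1) ^ h * F u"
        unfolding e_def by (intro cong_mult per cong_refl)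
      thus ?thesis unfolding if_P[OF True] .
    qed simp
    hence "(1 + (u\<^sup>2 - 4) ^ h) * G u + (if u = int p - 2 then e else 0)
        \<equiv>\<^sub>p (1 + (u\<^sup>2 - 4) ^ h) * G u + (if u = int p - 2 then (-1) ^ h * F u else 0)"
      by (intro cong_add cong_refl)
    also have "(1 + (u\<^sup>2 - 4) ^ h) * G u + (if u = int p - 2 then (-1) ^ h * F u else 0)
        = ((1 + (u\<^sup>2 - 4) ^ h) * (u + 2) ^ h + (if u = int p - 2 then (-1) ^ h else 0)) * F u"
      by (cases "u = int p - 2") (simp_all add: G_def distrib_right)
    also have "\<dots> \<equiv>\<^sub>p ((u + 2) ^ h + (u - 2) ^ h) * F u"
      by (intro cong_mult cong_refl twisted_weight u)
    also have "((u + 2) ^ h + (u - 2) ^ h) * F u = poly P (u + c) * (u + c) ^ (p - 2)"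
    proof -
      have "2 - c + (u + c) * 1 = u + 2" "- 2 - c + (u + c) * 1 = u - 2" by simp_all
      thus ?thesis
        by (simp only: P_def F_def poly_add poly_1 poly_power poly_pCons poly_0 mult_zero_right add_0_right)
    qed
    finally show "(1 + (u\<^sup>2 - 4) ^ h) * G u + (if u = int p - 2 then e else 0)
      \<equiv>\<^sub>p poly P (u + c) * (u + c) ^ (p - 2)" .
  qed
  also have "(\<Sum>u\<in>res. poly P (u + c) * (u + c) ^ (p - 2)) \<equiv>\<^sub>p - poly (pderiv P) 0"
    by (rule sum_poly_shifted_power[OF deg])
  also have "- poly (pderiv P) 0 = - int h * ((2 - c) ^ (h - 1) + (- 2 - c) ^ (h - 1))"
    by (simp add: P_def pderiv_add pderiv_power pderiv_pCons algebra_simps)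
  finally have "2 * (c\<^sup>2 - 4) * S c (Suc h)
      \<equiv>\<^sub>p 2 * (c\<^sup>2 - 4) * (- int h * ((2 - c) ^ (h - 1) + (- 2 - c) ^ (h - 1)))"
    by (intro cong_mult cong_refl)
  also have "2 * (c\<^sup>2 - 4) * (- int h * ((2 - c) ^ (h - 1) + (- 2 - c) ^ (h - 1)))
      = - (2 * int h) * ((- 2 - c) * (2 - c) ^ h + (2 - c) * (- 2 - c) ^ h)"
  proof -
    have D: "c\<^sup>2 - 4 = (2 - c) * (- 2 - c)" by (simp add: power2_eq_square algebra_simps)
    have pow: "a ^ h = a * a ^ (h - 1)" for a :: int
      using power_minus_mult[OF h_pos, of a] by (simp add: mult.commute)
    have "2 * ((2 - c) * (- 2 - c)) * (- n * (A + B))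
        = - (2 * n) * ((- 2 - c) * ((2 - c) * A) + (2 - c) * ((- 2 - c) * B))" for A B n :: int
      by (simp add: algebra_simps)
    thus ?thesis unfolding D pow[of "2 - c"] pow[of "- 2 - c"] .
  qed
  also have "\<dots> \<equiv>\<^sub>p 1 * ((- 2 - c) * (2 - c) ^ h + (2 - c) * (- 2 - c) ^ h)"
    unfolding two_int_h by (intro cong_mult cong_refl) (simp add: cong_iff_dvd_diff)
  also have "1 * ((- 2 - c) * (2 - c) ^ h + (2 - c) * (- 2 - c) ^ h)
      \<equiv>\<^sub>p 1 * ((- 2 - c) * L (2 - c) + (2 - c) * L (- 2 - c))"
    by (intro cong_mult cong_add cong_refl cong_sym[OF euler])
  finally show ?thesis by simp
qed

subsection \<open>The determinant modulo squares\<close>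

text \<open>For \<open>y = 1 / x\<close> one has
  \<open>y\<^sup>2 * (x\<^sup>2 + c * x + 1) = y\<^sup>2 + c * y + 1\<close>, so inversion turns the
  exponent \<open>n\<close> into \<open>2 - n\<close> modulo \<open>p - 1\<close>. Its
  representative \<open>p + 1 - n\<close> stays in \<open>{2..p - 1}\<close>.\<close>

lemma S_palindromic:
  assumes "n \<in> {2..p - 1}"
  shows "S c n \<equiv>\<^sub>p S c (p + 1 - n)"
proof -
  have "(\<Sum>x\<in>units. (x ^ (p - 2)) ^ n * entry c 1 (x ^ (p - 2)) 1) \<equiv>\<^sub>p S c n"
    unfolding S_def
    by (rule sum_units_inverse[where F = "\<lambda>x. x ^ n * entry c 1 x 1"])
      (intro cong_mult cong_pow entry_cong cong_refl)
  moreover have "(\<Sum>x\<in>units. (x ^ (p - 2)) ^ n * entry c 1 (x ^ (p - 2)) 1) \<equiv>\<^sub>p S c (p + 1 - n)"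
    unfolding S_def
  proof (rule cong_sum)
    fix x assume x: "x \<in> units"
    define y where "y = x ^ (p - 2)"
    note nd = not_dvd_unit[OF x]
    have xy: "x * y \<equiv>\<^sub>p 1" unfolding y_def by (rule unit_inverse[OF nd])
    have "y\<^sup>2 * (x\<^sup>2 + c * x * 1 + 1 * 1\<^sup>2) = (x * y)\<^sup>2 + c * y * (x * y) + y\<^sup>2"
      by (simp add: power2_eq_square algebra_simps)
    also have "\<dots> \<equiv>\<^sub>p 1\<^sup>2 + c * y * 1 + y\<^sup>2"
      by (intro cong_add cong_mult cong_pow xy cong_refl)
    also have "1\<^sup>2 + c * y * 1 + y\<^sup>2 = y\<^sup>2 + c * y * 1 + 1 * 1\<^sup>2" by simp
    finally have "(y\<^sup>2 * (x\<^sup>2 + c * x * 1 + 1 * 1\<^sup>2)) ^ (p - 2) \<equiv>\<^sub>p entry c 1 y 1"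
      unfolding entry_def by (rule cong_pow)
    hence "y ^ (2 * (p - 2)) * entry c 1 x 1 \<equiv>\<^sub>p entry c 1 y 1"
      unfolding entry_def by (simp only: power_mult_distrib power_mult)
    hence "y ^ n * (y ^ (2 * (p - 2)) * entry c 1 x 1) \<equiv>\<^sub>p y ^ n * entry c 1 y 1"
      by (intro cong_mult cong_refl)
    hence 1: "y ^ (n + 2 * (p - 2)) * entry c 1 x 1 \<equiv>\<^sub>p y ^ n * entry c 1 y 1"
      by (simp only: power_add mult.assoc)
    have "y ^ (n + 2 * (p - 2)) = x ^ ((p - 2) * (n + 2 * (p - 2)))"
      unfolding y_def by (simp only: power_mult)
    also have "\<dots> \<equiv>\<^sub>p x ^ (p + 1 - n)"
    proof (rule fermat_power[OF nd])
      have "[int ((p - 2) * (n + 2 * (p - 2))) = int (p + 1 - n)] (mod int (p - 1))"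
      proof -
        \<comment> \<open>Modulo \<open>p - 1\<close> the factor \<open>p - 2\<close> is -1, so both
          exponents reduce to \<open>2 - n\<close>.\<close>
        have e: "int (p - 2) = int (p - 1) - 1" "int (p + 1 - n) = int (p - 1) + 2 - int n"
          using assms p_gt_2 by auto
        have "int ((p - 2) * (n + 2 * (p - 2))) - int (p + 1 - n)
            = int (p - 1) * (int n + 2 * int (p - 1) - 5)"
          unfolding of_nat_mult of_nat_add of_nat_numeral e by (simp add: algebra_simps)
        thus ?thesis by (simp only: cong_iff_dvd_diff dvd_triv_left)
      qed
      thus "[(p - 2) * (n + 2 * (p - 2)) = p + 1 - n] (mod p - 1)"
        by (simp only: cong_int_iff)
    qed
    finally have "y ^ (n + 2 * (p - 2)) * entry c 1 x 1 \<equiv>\<^sub>p x ^ (p + 1 - n) * entry c 1 x 1"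
      by (intro cong_mult cong_refl)
    thus "(x ^ (p - 2)) ^ n * entry c 1 (x ^ (p - 2)) 1 \<equiv>\<^sub>p x ^ (p + 1 - n) * entry c 1 x 1"
      using 1 unfolding y_def by (meson cong_sym cong_trans)
  qed
  ultimately show ?thesis by (meson cong_sym cong_trans)
qed

text \<open>The reflection \<open>n \<mapsto> 2 - n\<close> modulo \<open>p - 1\<close> fixes
  exactly 1 and \<open>h + 1\<close>. Every other index pairs with a different one.\<close>

lemma prod_S: "(\<Prod>n = 1..p - 1. S c n) \<equiv>\<^sub>p S c 1 * S c (Suc h) * (\<Prod>n = 2..h. S c n)\<^sup>2"
proof -
  define k where "k = h"
  have k: "p - 1 = 2 * k" "p + 1 = 2 * k + 2" "k > 0"
    unfolding k_def using two_h p_gt_2 by linarith+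
  have split: "{1..p - 1} = insert 1 (insert (Suc k) ({2..k} \<union> {k + 2..2 * k}))"
    unfolding k using k(3) by auto
  have "(\<Prod>n = k + 2..2 * k. S c n) = (\<Prod>n = 2..k. S c (p + 1 - n))"
    unfolding k(2)
    by (rule prod.reindex_bij_witness[of _ "\<lambda>n. 2 * k + 2 - n" "\<lambda>n. 2 * k + 2 - n"]) auto
  also have "\<dots> \<equiv>\<^sub>p (\<Prod>n = 2..k. S c n)"
    by (intro cong_prod cong_sym[OF S_palindromic]) (use k in auto)
  finally have "S c 1 * S c (Suc k) * (\<Prod>n = 2..k. S c n) * (\<Prod>n = k + 2..2 * k. S c n)
      \<equiv>\<^sub>p S c 1 * S c (Suc k) * (\<Prod>n = 2..k. S c n) * (\<Prod>n = 2..k. S c n)"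
    by (intro cong_mult cong_refl)
  moreover have "(\<Prod>n = 1..p - 1. S c n)
      = S c 1 * S c (Suc k) * (\<Prod>n = 2..k. S c n) * (\<Prod>n = k + 2..2 * k. S c n)"
    unfolding split using k(3) by (simp add: prod.union_disjoint mult.assoc)
  ultimately show ?thesis
    unfolding k_def power2_eq_square by (simp only: mult.assoc)
qed

lemma not_dvd_prod_units: "\<not> int p dvd (\<Prod>x\<in>units. x)"
  using prime_dvd_prod_iff[OF _ prime_int, of units "\<lambda>x. x"] not_dvd_unit by auto

text \<open>Nonvanishing of the determinant forces the paired product to be prime to
  \<open>p\<close>, so its square, like the square on the left of \<open>det_D_mat\<close>, has
  symbol 1.\<close>

lemma L_det_D_mat:
  assumes nz: "\<not> int p dvd det (D_mat p c 1)"
  shows "L (det (D_mat p c 1)) = L (S c 1 * S c (Suc h))"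
proof -
  define Q where "Q = (\<Prod>n = 2..h. S c n)"
  have *: "(\<Prod>x\<in>units. x)\<^sup>2 * det (D_mat p c 1) \<equiv>\<^sub>p S c 1 * S c (Suc h) * Q\<^sup>2"
    unfolding Q_def by (rule cong_trans[OF det_D_mat prod_S])
  have "\<not> int p dvd S c 1 * S c (Suc h) * Q\<^sup>2"
    using cong_dvd_iff[OF *] not_dvd_mult[OF not_dvd_power[OF not_dvd_prod_units] nz] by blast
  hence "\<not> int p dvd Q"
    using dvd_mult dvd_mult2 unfolding power2_eq_square by blast
  hence "L Q * L Q = 1" by (rule L_square)
  hence "L (Q\<^sup>2) = 1" by (simp only: power2_eq_square L_mult)
  moreover have "L ((\<Prod>x\<in>units. x)\<^sup>2) = 1"
    by (simp only: power2_eq_square L_mult L_square[OF not_dvd_prod_units])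
  ultimately show ?thesis
    using L_cong[OF *] by (simp only: L_mult mult_1 mult_1_right)
qed

section \<open>The residue and nonresidue cases\<close>

lemma L_sign_of_factor:
  assumes "\<not> int p dvd c\<^sup>2 - 4"
  shows "L (- c - 2) = 1 \<or> L (- c - 2) = -1"
proof -
  have "c\<^sup>2 - 4 = (- c - 2) * (2 - c)" by (simp add: power2_eq_square algebra_simps)
  hence "\<not> int p dvd - c - 2" using assms by auto
  thus ?thesis using L_values[of "- c - 2"] L_0_iff[of "- c - 2"] by auto
qed

text \<open>The product of the evaluations in \<open>S_one\<close> and \<open>S_half\<close>: the
  two factors \<open>c\<^sup>2 - 4\<close> on the left form a square, leaving only
  \<open>L 2\<close>. Both symbols on the right are expressed through \<open>\<eta>\<close>, so that
  fixing the sign of \<open>L (c\<^sup>2 - 4)\<close> collapses the bracket.\<close>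

lemma L_det_cases:
  assumes nz: "\<not> int p dvd det (D_mat p c 1)" and D: "\<not> int p dvd c\<^sup>2 - 4"
  defines "\<eta> \<equiv> L (- c - 2)"
  shows "L 2 * L (det (D_mat p c 1))
    = L (- c * L (c\<^sup>2 - 4) * ((- 2 - c) * (L (c\<^sup>2 - 4) * \<eta>) + (2 - c) * \<eta>))"
proof -
  define D where "D = c\<^sup>2 - 4"
  have D': "\<not> int p dvd D" using D by (simp add: D_def)
  have eta: "\<eta> = L (- 2 - c)" unfolding \<eta>_def by (rule arg_cong[where f = L]) simp
  have D_eq: "D = (2 - c) * (- 2 - c)" by (simp add: D_def power2_eq_square algebra_simps)
  from D_eq have LD: "L D = L (2 - c) * \<eta>" by (simp add: L_mult eta)
  have "\<not> int p dvd - 2 - c" using D' unfolding D_eq using dvd_mult by blast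
  hence "\<eta> * \<eta> = 1" unfolding eta by (rule L_square)
  hence La: "L (2 - c) = L D * \<eta>" using LD by simp
  have "(D * S c 1) * (2 * D * S c (Suc h))
      \<equiv>\<^sub>p (- c * L D) * ((- 2 - c) * (L D * \<eta>) + (2 - c) * \<eta>)"
    using cong_mult[OF S_one[of c] S_half[of c]] unfolding D_def[symmetric] La eta[symmetric] .
  hence "L ((D * S c 1) * (2 * D * S c (Suc h)))
      = L (- c * L D * ((- 2 - c) * (L D * \<eta>) + (2 - c) * \<eta>))"
    by (rule L_cong)
  moreover have "L ((D * S c 1) * (2 * D * S c (Suc h))) = (L D * L D) * (L 2 * L (S c 1 * S c (Suc h)))"
    by (simp only: L_mult mult_ac)
  ultimately show ?thesis
    unfolding L_det_D_mat[OF nz] D_def[symmetric] L_square[OF D'] by simp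
qed

lemma L_det_residue:
  assumes nz: "\<not> int p dvd det (D_mat p c 1)" and D: "L (c\<^sup>2 - 4) = 1"
  shows "L (det (D_mat p c 1)) = L (- c - 2) ^ h"
proof -
  define \<eta> where "\<eta> = L (- c - 2)"
  have nD: "\<not> int p dvd c\<^sup>2 - 4" using D L_0_iff[of "c\<^sup>2 - 4"] by simp
  have eta: "\<eta> = 1 \<or> \<eta> = -1"
    unfolding \<eta>_def by (rule L_sign_of_factor[OF nD])
  \<comment> \<open>For symbol 1 the bracket is \<open>- 2 * c * \<eta>\<close>.\<close>
  have "L 2 * L (det (D_mat p c 1)) = L (2 * (c * c * \<eta>))"
    unfolding L_det_cases[OF nz nD] D \<eta>_def[symmetric]
    by (rule arg_cong[where f = L]) (simp add: algebra_simps)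
  hence *: "L (det (D_mat p c 1)) = L c * L c * L \<eta>"
    using not_dvd_2 L_0_iff[of 2] by (simp add: L_mult)
  \<comment> \<open>If \<open>p\<close> divided \<open>c\<close>, the symbol of the determinant
    would be 0, against the assumption.\<close>
  have "L c \<noteq> 0" using * nz L_0_iff[of "det (D_mat p c 1)"] by auto
  hence "L c * L c = 1" using L_square[of c] L_0_iff[of c] by blast
  thus ?thesis using * L_sign[OF eta] by (simp add: \<eta>_def)
qed

lemma L_det_nonresidue:
  assumes nz: "\<not> int p dvd det (D_mat p c 1)" and D: "L (c\<^sup>2 - 4) = -1"
  shows "L (det (D_mat p c 1)) = L (- c - 2) ^ h * L (2 * c)"
proof -
  define \<eta> where "\<eta> = L (- c - 2)"
  have nD: "\<not> int p dvd c\<^sup>2 - 4" using D L_0_iff[of "c\<^sup>2 - 4"] by simp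
  have eta: "\<eta> = 1 \<or> \<eta> = -1"
    unfolding \<eta>_def by (rule L_sign_of_factor[OF nD])
  \<comment> \<open>For symbol -1 the terms with \<open>c\<close> cancel and the bracket is
    \<open>4 * \<eta>\<close>. One factor \<open>c\<close> is therefore left unsquared.\<close>
  have "L 2 * L (det (D_mat p c 1)) = L (2 * (\<eta> * (2 * c)))"
    unfolding L_det_cases[OF nz nD] D \<eta>_def[symmetric]
    by (rule arg_cong[where f = L]) (simp add: algebra_simps)
  hence "L 2 * L (det (D_mat p c 1)) = L 2 * (L \<eta> * L (2 * c))"
    by (simp only: L_mult)
  hence "L (det (D_mat p c 1)) = L \<eta> * L (2 * c)"
    using not_dvd_2 L_0_iff[of 2] by (simp only: mult_cancel_left) simp
  thus ?thesis using L_sign[OF eta] by (simp add: \<eta>_def)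
qed

end

theorem corollary1:
  fixes p :: nat and c d :: int
  assumes "prime p" and "odd p"
    and "\<not> int p dvd det (D_mat p c 1)"
  shows "(Legendre (c\<^sup>2 - 4) (int p) = 1 \<longrightarrow>
            Legendre (det (D_mat p c 1)) (int p) = Legendre (- c - 2) (int p) ^ ((p - 1) div 2))
       \<and> (Legendre (c\<^sup>2 - 4) (int p) = -1 \<longrightarrow>
            Legendre (det (D_mat p c 1)) (int p)
              = Legendre (- c - 2) (int p) ^ ((p - 1) div 2) * Legendre (2 * c) (int p))
       \<and> (\<not> int p dvd d \<longrightarrow>
            (\<forall>d' :: int. [d * d' = 1] (mod int p) \<longrightarrow>
              Legendre (det (D_mat p c (d\<^sup>2))) (int p)
                = Legendre d (int p) ^ ((p - 1) div 2) * Legendre (det (D_mat p (c * d') 1)) (int p)))"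
proof -
  interpret odd_prime p by unfold_locales fact+
  show ?thesis
    using L_det_residue L_det_nonresidue L_det_D_mat_square assms(3) by blast
qed

end
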